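(* Let $N\ge 1$ and $n\ge 0$ be integers. The Quasi-Hermite polynomials satisfy, for all $x,y\in\mathbb{R}$, $$\partial_y H_n(x,y;N)=\partial_x^2\left(1+\frac{y}{N}\partial_x^2\right)^{N-1}x^n.$$
   Context: For an integer $N\ge 1$, real $y$ and integer $n\ge 0$, the Quasi-Hermite polynomial is defined by $H_n(x,y;N)=\left(1+\frac{y}{N}\partial_x^2\right)^N x^n$, where $\partial_x$ and $\partial_y$ denote partial differentiation with respect to $x$ and $y$. *)

theory Defs
  imports "HOL-Analysis.Analysis"
begin

text \<open>The operator \<open>1 + (y/N) \<partial>\<^sub>x\<^sup>2\<close> acting on real functions of \<open>x\<close>.
  It is only ever applied to (iterated images of) monomials, which are polynomial
  functions, so the total operator \<^const>\<open>deriv\<close> always denotes a genuine derivative.\<close>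

definition qh_op :: "nat \<Rightarrow> real \<Rightarrow> (real \<Rightarrow> real) \<Rightarrow> (real \<Rightarrow> real)" where
  "qh_op N y f = (\<lambda>x. f x + (y / real N) * (deriv ^^ 2) f x)"

definition quasi_hermite :: "nat \<Rightarrow> real \<Rightarrow> real \<Rightarrow> nat \<Rightarrow> real" where
  "quasi_hermite n x y N = (qh_op N y ^^ N) (\<lambda>t. t ^ n) x"

end

theory Submission
  imports Defs "HOL-Computational_Algebra.Polynomial"
begin

text \<open>On polynomials, \<open>A c = 1 + c \<partial>\<^sup>2\<close> commutes with \<open>\<partial>\<^sup>2\<close>, so the powers of \<open>A c\<close> can be
  differentiated in \<open>c\<close> by the scalar rule \<open>d/dc (1 + c z)\<^sup>m = m z (1 + c z)\<^sup>m\<^sup>-\<^sup>1\<close>.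
  With \<open>c = y/N\<close> and \<open>m = N\<close>, the chain rule factor \<open>1/N\<close> cancels the exponent.\<close>

definition poly_heat :: "real \<Rightarrow> real poly \<Rightarrow> real poly" where
  "poly_heat c p = p + smult c (pderiv (pderiv p))"

lemma deriv_poly: "deriv (poly p) = poly (pderiv p)" for p :: "real poly"
  by (intro ext DERIV_imp_deriv poly_DERIV)

lemma deriv2_poly: "(deriv ^^ 2) (poly p) = poly (pderiv (pderiv p))" for p :: "real poly"
  by (simp add: numeral_2_eq_2 deriv_poly)

lemma qh_op_poly: "qh_op N y (poly p) = poly (poly_heat (y / real N) p)"
  by (rule ext) (simp add: qh_op_def poly_heat_def deriv2_poly)

text \<open>Moves the problem from functions with \<open>deriv\<close> to polynomials, where
  \<open>pderiv\<close> is purely algebraic and linear.\<close>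

lemma qh_op_funpow_poly:
  "(qh_op N y ^^ m) (poly p) = poly ((poly_heat (y / real N) ^^ m) p)"
  by (induction m) (simp_all add: qh_op_poly)

lemma pderiv2_poly_heat_funpow:
  "pderiv (pderiv ((poly_heat c ^^ m) p)) = (poly_heat c ^^ m) (pderiv (pderiv p))"
  by (induction m) (simp_all add: poly_heat_def pderiv_add pderiv_smult)

lemma has_real_derivative_poly_heat_funpow:
  "((\<lambda>c. poly ((poly_heat c ^^ m) p) x) has_real_derivative
     real m * poly (pderiv (pderiv ((poly_heat c ^^ (m - 1)) p))) x) (at c)"
\<comment> \<open>\<open>p\<close> must vary: the induction hypothesis is used at \<open>p\<close>
  and at its second derivative.\<close>
proof (induction m arbitrary: p)
  case 0
  show ?case by simp
next
  case (Suc m)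
  let ?q = "pderiv (pderiv p)"
  \<comment> \<open>Peel off the outermost factor and commute its second derivative inward onto
    \<open>p\<close>, so that \<open>b\<close> occurs only in a scalar factor and in
    \<open>m\<close>-th powers.\<close>
  have step: "poly ((poly_heat b ^^ Suc m) p) x
      = poly ((poly_heat b ^^ m) p) x + b * poly ((poly_heat b ^^ m) ?q) x" for b
    by (simp add: poly_heat_def pderiv2_poly_heat_funpow)
  have "((\<lambda>b. poly ((poly_heat b ^^ m) p) x + b * poly ((poly_heat b ^^ m) ?q) x)
      has_real_derivative
        real m * poly (pderiv (pderiv ((poly_heat c ^^ (m - 1)) p))) x
        + (1 * poly ((poly_heat c ^^ m) ?q) x
           + real m * poly (pderiv (pderiv ((poly_heat c ^^ (m - 1)) ?q))) x * c)) (at c)"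
    by (intro DERIV_add DERIV_mult DERIV_ident Suc.IH)
  also have "real m * poly (pderiv (pderiv ((poly_heat c ^^ (m - 1)) p))) x
        + (1 * poly ((poly_heat c ^^ m) ?q) x
           + real m * poly (pderiv (pderiv ((poly_heat c ^^ (m - 1)) ?q))) x * c)
      = real (Suc m) * poly (pderiv (pderiv ((poly_heat c ^^ (Suc m - 1)) p))) x"
    \<comment> \<open>For \<open>m = 0\<close> the factor \<open>real m\<close> kills the terms with
      truncated \<open>m - 1\<close>. Otherwise the two terms with factor \<open>real m\<close>
      recombine into \<open>m\<close> copies of the \<open>m\<close>-th power at
      \<open>?q\<close>.\<close>
    by (cases m) (simp_all add: pderiv2_poly_heat_funpow poly_heat_def
        pderiv_add pderiv_smult algebra_simps)
  finally show ?case unfolding step .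
qed

theorem corollary4:
  fixes N n :: nat and x y :: real
  assumes "N \<ge> 1"
  shows "((\<lambda>v. quasi_hermite n x v N) has_real_derivative
           (deriv ^^ 2) ((qh_op N y ^^ (N - 1)) (\<lambda>t. t ^ n)) x) (at y)"
proof -
  have monom: "(\<lambda>t. t ^ n) = poly (monom (1::real) n)"
    by (simp add: fun_eq_iff poly_monom)
  have "((\<lambda>v. poly ((poly_heat (v / real N) ^^ N) (monom 1 n)) x) has_real_derivative
      real N * poly (pderiv (pderiv ((poly_heat (y / real N) ^^ (N - 1)) (monom 1 n)))) x
      * (1 / real N)) (at y)"
    by (rule DERIV_chain2[OF has_real_derivative_poly_heat_funpow])
       (intro DERIV_cdivide DERIV_ident)
  \<comment> \<open>\<open>N \<ge> 1\<close> ensures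
    \<open>real N * (1 / real N) = 1\<close>.\<close>
  then show ?thesis
    using assms by (simp add: quasi_hermite_def monom qh_op_funpow_poly deriv2_poly)
qed

end
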